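(* Let $h:A\to\mathbb{N}$ be an increasing function with $A\subseteq\mathbb{N}$ and $h(a)>a$ for all $a\in A$, and let $(h_\alpha)_{\alpha<\epsilon_0}$ be its Hardy-like hierarchy. Let $\alpha,\beta<\epsilon_0$ with $\beta>0$, and let $x>0$ be an integer. If $h_{\beta\oplus\alpha}(x)$ is defined, then $h_{\{\beta\}(x)\oplus\alpha}(h(x))$ is defined and $$h_{\beta\oplus\alpha}(x)=h_{\{\beta\oplus\alpha\}(x)}(h(x))\geq h_{\{\beta\}(x)\oplus\alpha}(h(x)).$$
   Context: $\oplus$ is the natural (Hessenberg) sum of ordinals (coefficient-wise sum in Cantor normal form). Fundamental sequences: $\{0\}(x)=0$; for $\alpha\neq0$ write $\alpha=\delta+\omega^\gamma$ in Cantor normal form with $\omega^\gamma$ the last term; then $\{\alpha\}(x)=\delta$ if $\gamma=0$, $\delta+\omega^{\gamma'}\cdot x$ if $\gamma=\gamma'+1$, $\delta+\omega^{\{\gamma\}(x)}$ if $\gamma$ is a limit. Hardy-like hierarchy of partial functions: $h_0(x)=x$ for all $x\in\mathbb{N}$; for $\alpha>0$, $h_\alpha(x)=h_{\{\alpha\}(x)}(h(x))$ if $x\in\operatorname{dom}h$ and $h(x)\in\operatorname{dom}h_{\{\alpha\}(x)}$, and $h_\alpha(x)$ is undefined otherwise. *)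

theory Defs
  imports Main
begin

text \<open>Ordinals below \<open>\<epsilon>\<^sub>0\<close> are represented by their hereditary Cantor normal forms:
  \<open>CNF [\<gamma>\<^sub>1, \<dots>, \<gamma>\<^sub>n]\<close> with \<open>\<gamma>\<^sub>1 \<ge> \<dots> \<ge> \<gamma>\<^sub>n\<close> stands for
  \<open>\<omega>\<^bsup>\<gamma>\<^sub>1\<^esup> + \<dots> + \<omega>\<^bsup>\<gamma>\<^sub>n\<^esup>\<close>, a coefficient being the multiplicity of an exponent.
  The order is the lexicographic comparison of normal forms.\<close>

datatype cnf = CNF (exps: "cnf list")

fun cnf_less :: "cnf \<Rightarrow> cnf \<Rightarrow> bool" where
  "cnf_less (CNF xs) (CNF []) = False"
| "cnf_less (CNF []) (CNF (y # ys)) = True"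
| "cnf_less (CNF (x # xs)) (CNF (y # ys)) =
     (cnf_less x y \<or> x = y \<and> cnf_less (CNF xs) (CNF ys))"

lemma cnf_less_irrefl: "\<not> cnf_less a a"
proof (induction a)
  case (CNF xs)
  then show ?case by (induction xs) auto
qed

lemma cnf_less_trans: "cnf_less a b \<Longrightarrow> cnf_less b c \<Longrightarrow> cnf_less a c"
proof (induction a b arbitrary: c rule: cnf_less.induct)
  case (2 y ys)
  then show ?case by (cases c; cases "exps c") auto
next
  case (3 x xs y ys)
  then show ?case by (cases c; cases "exps c") auto
qed auto

lemma cnf_less_total: "cnf_less a b \<or> a = b \<or> cnf_less b a"
proof (induction a b rule: cnf_less.induct)
  case (1 xs)
  then show ?case by (cases xs) auto
qed auto

instantiation cnf :: linorder
begin

definition less_cnf :: "cnf \<Rightarrow> cnf \<Rightarrow> bool" where "less_cnf = cnf_less"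
definition less_eq_cnf :: "cnf \<Rightarrow> cnf \<Rightarrow> bool" where "less_eq_cnf a b = (a = b \<or> cnf_less a b)"

instance
  by standard
    (use cnf_less_irrefl cnf_less_trans cnf_less_total in
      \<open>unfold less_cnf_def less_eq_cnf_def; blast\<close>)+

end

lemma less_cnf_simps [simp]:
  "\<not> CNF xs < CNF []"
  "CNF [] < CNF (y # ys)"
  "CNF (x # xs) < CNF (y # ys) \<longleftrightarrow> x < y \<or> x = y \<and> CNF xs < CNF ys"
  by (simp_all add: less_cnf_def)

fun is_cnf :: "cnf \<Rightarrow> bool" where
  "is_cnf (CNF xs) \<longleftrightarrow> sorted_wrt (\<ge>) xs \<and> (\<forall>x\<in>set xs. is_cnf x)"

definition cnf_rel :: "(cnf \<times> cnf) set" where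
  "cnf_rel = {(s, t). is_cnf s \<and> is_cnf t \<and> s < t}"

lemma cnf_acc_step:
  assumes a: "is_cnf a"
    and IH: "\<And>b t. (b, a) \<in> cnf_rel \<Longrightarrow> is_cnf t \<Longrightarrow> \<forall>e\<in>set (exps t). e \<le> b \<Longrightarrow> t \<in> Wellfounded.acc cnf_rel"
    and t: "is_cnf t" "\<forall>e\<in>set (exps t). e \<le> a"
  shows "t \<in> Wellfounded.acc cnf_rel"
proof -
  have small: "CNF r \<in> Wellfounded.acc cnf_rel"
    if "is_cnf (CNF r)" "\<forall>e\<in>set r. e < a" for r
  proof (cases r)
    case Nil
    show ?thesis
      by (rule acc.accI) (auto simp: cnf_rel_def Nil, metis cnf.exhaust less_cnf_simps(1))
  next
    case (Cons b bs)
    show ?thesis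
      by (rule IH[of b]) (use that Cons a in \<open>auto simp: cnf_rel_def\<close>)
  qed
  have split: "\<exists>n r. xs = replicate n a @ r \<and> (\<forall>e\<in>set r. e < a)"
    if "sorted_wrt (\<ge>) xs" "\<forall>e\<in>set xs. e \<le> a" for xs
    using that
  proof (induction xs)
    case Nil
    then show ?case by simp
  next
    case (Cons y ys)
    show ?case
    proof (cases "y = a")
      case True
      from Cons obtain n r where "ys = replicate n a @ r" "\<forall>e\<in>set r. e < a" by auto
      with True show ?thesis by (intro exI[of _ "Suc n"] exI[of _ r]) auto
    next
      case False
      with Cons.prems show ?thesis
        by (intro exI[of _ 0] exI[of _ "y # ys"]) force
    qed
  qed
  have cmp: "m < n \<or> m = n \<and> CNF q < CNF r"
    if "CNF (replicate m a @ q) < CNF (replicate n a @ r)"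
       "\<forall>e\<in>set q. e < a" "\<forall>e\<in>set r. e < a" for m n q r
    using that
  proof (induction m arbitrary: n)
    case 0
    then show ?case by (cases n) auto
  next
    case (Suc m)
    show ?case
    proof (cases n)
      case 0
      with Suc.prems show ?thesis by (cases r) auto
    next
      case (Suc n')
      with Suc.prems Suc.IH[of n'] show ?thesis by auto
    qed
  qed
  have bounded: "\<forall>e\<in>set s. e \<le> a"
    if "is_cnf (CNF s)" "CNF s < CNF (replicate n a @ r)" "\<forall>e\<in>set r. e < a" for s n r
  proof (cases s)
    case (Cons b bs)
    have "b \<le> a"
      using that Cons by (cases n; cases r) auto
    with that(1) Cons show ?thesis by auto
  qed simp
  have main: "CNF (replicate n a @ r) \<in> Wellfounded.acc cnf_rel"
    if "is_cnf (CNF r)" "\<forall>e\<in>set r. e < a" for n r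
    using that
  proof (induction n arbitrary: r rule: less_induct)
    case (less n)
    have inner: "CNF (replicate n a @ exps u) \<in> Wellfounded.acc cnf_rel"
      if "u \<in> Wellfounded.acc cnf_rel" "is_cnf u" "\<forall>e\<in>set (exps u). e < a" for u
      using that
    proof (induction u rule: acc.induct)
      case (accI u)
      obtain r where u: "u = CNF r" by (cases u)
      show ?case
      proof (rule acc.accI)
        fix s assume "(s, CNF (replicate n a @ exps u)) \<in> cnf_rel"
        then have s: "(s, CNF (replicate n a @ r)) \<in> cnf_rel" by (simp add: u)
        have r: "\<forall>e\<in>set r. e < a" "is_cnf (CNF r)" using accI u by auto
        obtain ss where ss: "s = CNF ss" by (cases s)
        have "\<forall>e\<in>set ss. e \<le> a"
          using bounded[of ss n r] s ss r by (auto simp: cnf_rel_def)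
        then obtain m q where mq: "ss = replicate m a @ q" "\<forall>e\<in>set q. e < a"
          using split[of ss] s ss by (auto simp: cnf_rel_def)
        have q: "is_cnf (CNF q)"
          using s ss mq by (auto simp: cnf_rel_def sorted_wrt_append)
        have "m < n \<or> m = n \<and> CNF q < CNF r"
          using cmp[of m q n r] s ss mq r by (auto simp: cnf_rel_def)
        then show "s \<in> Wellfounded.acc cnf_rel"
        proof
          assume "m < n"
          with less.IH[of m q] q mq ss show ?thesis by simp
        next
          assume mn: "m = n \<and> CNF q < CNF r"
          then have "(CNF q, u) \<in> cnf_rel" using q r u by (simp add: cnf_rel_def)
          from accI.IH[OF this] q mq mn ss show ?thesis by simp
        qed
      qed
    qed
    show ?case
      using inner[of "CNF r"] small[of r] less.prems by simp
  qed
  obtain ts where ts: "t = CNF ts" by (cases t)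
  obtain n r where nr: "ts = replicate n a @ r" "\<forall>e\<in>set r. e < a"
    using split[of ts] t ts by auto
  have "is_cnf (CNF r)" using t ts nr by (auto simp: sorted_wrt_append)
  with main nr ts show ?thesis by simp
qed

lemma cnf_acc: "is_cnf t \<Longrightarrow> t \<in> Wellfounded.acc cnf_rel"
proof (induction t)
  case (CNF xs)
  have bnd: "t \<in> Wellfounded.acc cnf_rel"
    if "a \<in> Wellfounded.acc cnf_rel" "is_cnf a" "is_cnf t" "\<forall>e\<in>set (exps t). e \<le> a" for a t
    using that
  proof (induction a arbitrary: t rule: acc.induct)
    case (accI a)
    show ?case
      by (rule cnf_acc_step[of a]) (use accI in \<open>auto simp: cnf_rel_def\<close>)
  qed
  show ?case
  proof (cases xs)
    case Nil
    show ?thesis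
      by (rule acc.accI) (auto simp: cnf_rel_def Nil, metis cnf.exhaust less_cnf_simps(1))
  next
    case (Cons a as)
    show ?thesis
      by (rule bnd[of a]) (use CNF Cons in auto)
  qed
qed

typedef eps0 = "{t. is_cnf t}"
  by (rule exI[of _ "CNF []"]) simp

setup_lifting type_definition_eps0

instantiation eps0 :: "{wellorder, zero}"
begin

lift_definition zero_eps0 :: eps0 is "CNF []" by simp
lift_definition less_eps0 :: "eps0 \<Rightarrow> eps0 \<Rightarrow> bool" is "(<)" .
lift_definition less_eq_eps0 :: "eps0 \<Rightarrow> eps0 \<Rightarrow> bool" is "(\<le>)" .

instance
proof
  fix a b c :: eps0
  show "a < b \<longleftrightarrow> a \<le> b \<and> \<not> b \<le> a" by transfer auto
  show "a \<le> a" by transfer auto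
  show "a \<le> b \<Longrightarrow> b \<le> c \<Longrightarrow> a \<le> c" by transfer auto
  show "a \<le> b \<Longrightarrow> b \<le> a \<Longrightarrow> a = b" by transfer auto
  show "a \<le> b \<or> b \<le> a" by transfer auto
next
  fix P :: "eps0 \<Rightarrow> bool" and a
  assume step: "\<And>x. (\<And>y. y < x \<Longrightarrow> P y) \<Longrightarrow> P x"
  have "P (Abs_eps0 t)" if "t \<in> Wellfounded.acc cnf_rel" "is_cnf t" for t
    using that
  proof (induction t rule: acc.induct)
    case (accI t)
    show ?case
    proof (rule step)
      fix y assume y: "y < Abs_eps0 t"
      have c: "is_cnf (Rep_eps0 y)" using Rep_eps0[of y] by simp
      have "(Rep_eps0 y, t) \<in> cnf_rel"
        using y accI c by (simp add: cnf_rel_def less_eps0.rep_eq Abs_eps0_inverse)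
      with accI c have "P (Abs_eps0 (Rep_eps0 y))" by blast
      then show "P y" by (simp add: Rep_eps0_inverse)
    qed
  qed
  from this[of "Rep_eps0 a"] show "P a"
    using Rep_eps0[of a] cnf_acc by (simp add: Rep_eps0_inverse)
qed

end

text \<open>The natural sum adds coefficients, i.e. it forms the non-increasing list of all exponents
  of both summands.\<close>

lift_definition natural_sum :: "eps0 \<Rightarrow> eps0 \<Rightarrow> eps0" (infixl "\<oplus>" 65)
  is "\<lambda>a b. CNF (rev (sort (exps a @ exps b)))"
proof -
  fix a b assume "is_cnf a" "is_cnf b"
  then show "is_cnf (CNF (rev (sort (exps a @ exps b))))"
    by (cases a; cases b) (auto simp: sorted_wrt_rev)
qed

text \<open>Writing \<open>\<alpha> = \<delta> + \<omega>\<^bsup>\<gamma>\<^esup>\<close> with last term \<open>\<omega>\<^bsup>\<gamma>\<^esup>\<close>, \<open>\<gamma>\<close> is a successor iff its own last exponent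
  is \<open>0\<close>, and its predecessor is then obtained by dropping that exponent. Below, \<open>\<delta>\<close> is a list of
  exponents.\<close>

function cnf_fund :: "cnf \<Rightarrow> nat \<Rightarrow> cnf" where
  "cnf_fund (CNF xs) x =
     (if xs = [] then CNF []
      else let \<delta> = butlast xs; \<gamma> = last xs in
        if exps \<gamma> = [] then CNF \<delta>
        else if last (exps \<gamma>) = CNF [] then CNF (\<delta> @ replicate x (CNF (butlast (exps \<gamma>))))
        else CNF (\<delta> @ [cnf_fund \<gamma> x]))"
  by pat_completeness auto
termination
proof (relation "measure (size \<circ> fst)", goal_cases)
  case (2 xs x \<delta> \<gamma>)
  then have "\<gamma> \<in> set xs" by simp
  then show ?case by (simp add: less_Suc_eq_le size_list_estimation')
qed simp

declare cnf_fund.simps [simp del]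

lemma cnf_less_append: "CNF r < CNF s \<Longrightarrow> CNF (d @ r) < CNF (d @ s)"
  by (induction d) auto

lemma cnf_less_butlast: "xs \<noteq> [] \<Longrightarrow> CNF (butlast xs) < CNF xs"
  by (induction xs) auto

lemma cnf_fund_wf:
  assumes "is_cnf a" "a \<noteq> CNF []"
  shows "is_cnf (cnf_fund a x) \<and> cnf_fund a x < a"
  using assms
proof (induction a x rule: cnf_fund.induct)
  case (1 xs x)
  define \<delta> \<gamma> where "\<delta> = butlast xs" and "\<gamma> = last xs"
  have ne: "xs \<noteq> []" using 1 by simp
  then have xs: "xs = \<delta> @ [\<gamma>]" by (simp add: \<delta>_def \<gamma>_def)
  have props: "sorted_wrt (\<ge>) \<delta>" "\<forall>e\<in>set \<delta>. is_cnf e \<and> \<gamma> \<le> e" "is_cnf \<gamma>"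
    using 1(2) unfolding xs by (auto simp: sorted_wrt_append)
  obtain gs where gs: "\<gamma> = CNF gs" by (cases \<gamma>)
  consider "gs = []" | "gs \<noteq> []" "last gs = CNF []" | "gs \<noteq> []" "last gs \<noteq> CNF []" by blast
  then show ?case
  proof cases
    case 1
    then have eq: "cnf_fund (CNF xs) x = CNF \<delta>"
      using ne gs by (simp add: cnf_fund.simps Let_def \<delta>_def \<gamma>_def)
    show ?thesis using eq props cnf_less_butlast[OF ne] by (simp add: \<delta>_def)
  next
    case 2
    define p where "p = CNF (butlast gs)"
    have eq: "cnf_fund (CNF xs) x = CNF (\<delta> @ replicate x p)"
      using ne gs 2 by (simp add: cnf_fund.simps Let_def p_def flip: \<delta>_def \<gamma>_def)
    have p: "p < \<gamma>" unfolding p_def gs by (rule cnf_less_butlast) (use 2 in simp)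
    have "sorted_wrt (\<ge>) gs" "\<forall>e\<in>set gs. is_cnf e" using props(3) gs by simp_all
    moreover have "gs = butlast gs @ [last gs]" using 2 by (metis append_butlast_last_id)
    ultimately have "sorted_wrt (\<ge>) (butlast gs)" by (metis sorted_wrt_append)
    then have "is_cnf p"
      using \<open>\<forall>e\<in>set gs. is_cnf e\<close> by (auto simp: p_def dest: in_set_butlastD)
    moreover have "p \<le> e" if "e \<in> set \<delta>" for e using props(2) p that by force
    moreover have "sorted_wrt (\<ge>) (replicate x p)" by (induction x) auto
    ultimately have "is_cnf (CNF (\<delta> @ replicate x p))"
      using props by (auto simp: sorted_wrt_append)
    moreover have "CNF (replicate x p) < CNF [\<gamma>]" using p by (cases x) auto
    ultimately show ?thesis using eq xs cnf_less_append by simp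
  next
    case 3
    have eq: "cnf_fund (CNF xs) x = CNF (\<delta> @ [cnf_fund \<gamma> x])"
      using ne gs 3 by (subst cnf_fund.simps) (simp add: Let_def flip: \<delta>_def \<gamma>_def)
    have IH: "is_cnf (cnf_fund \<gamma> x) \<and> cnf_fund \<gamma> x < \<gamma>"
      by (rule "1.IH"[OF ne \<delta>_def \<gamma>_def]) (use 3 gs props in auto)
    then have "is_cnf (CNF (\<delta> @ [cnf_fund \<gamma> x]))"
      using props by (force simp: sorted_wrt_append)
    with IH eq xs show ?thesis by (simp add: cnf_less_append)
  qed
qed

lift_definition fund_seq :: "eps0 \<Rightarrow> nat \<Rightarrow> eps0" is cnf_fund
  subgoal for a x
    using cnf_fund_wf[of a x] by (cases "a = CNF []") (simp_all add: cnf_fund.simps)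
  done

lemma fund_seq_zero [simp]: "fund_seq 0 x = 0"
  by transfer (simp add: cnf_fund.simps)

lemma fund_seq_less: "\<alpha> \<noteq> 0 \<Longrightarrow> fund_seq \<alpha> x < \<alpha>"
  by transfer (simp add: cnf_fund_wf)

text \<open>The partial function \<open>h : A \<rightarrow> \<nat>\<close> is given by its domain \<open>A\<close> and a total function whose
  values outside \<open>A\<close> are never used; \<open>None\<close> means undefined.\<close>

function hardy :: "nat set \<Rightarrow> (nat \<Rightarrow> nat) \<Rightarrow> eps0 \<Rightarrow> nat \<Rightarrow> nat option" where
  "hardy A h \<alpha> x =
     (if \<alpha> = 0 then Some x
      else if x \<in> A then hardy A h (fund_seq \<alpha> x) (h x)
      else None)"
  by pat_completeness auto
termination
  by (relation "inv_image {(a, b). a < b} (\<lambda>(A, h, \<alpha>, x). \<alpha>)")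
    (auto simp: fund_seq_less wf intro: wf_inv_image)

declare hardy.simps [simp del]

end

theory Submission
  imports Defs "HOL-Library.Multiset"
begin

text \<open>
  An ordinal below \<open>\<epsilon>\<^sub>0\<close> is the finite multiset of its exponents, and \<open>\<oplus>\<close> is multiset union.
  Along the orbit \<open>s\<close> of \<open>x\<close>, \<open>steps s a i\<close> is the index at which the descent from \<open>a\<close> started at
  index \<open>i\<close> reaches \<open>0\<close>; comparing Hardy values amounts to comparing such indices, which are total.
  They satisfy \<open>steps (d + b) = steps d \<circ> steps b\<close> for sums in normal form, and grow both with the
  starting index and along \<open>reach\<close>, iteration of \<open>{\<cdot>}(n)\<close>.

  It remains to replace one term \<open>\<omega>\<^sup>g\<close> of \<open>\<sigma> \<oplus> \<omega>\<^sup>g\<close> by \<open>{\<omega>\<^sup>g}(s i)\<close>, and the terms of \<open>\<sigma>\<close> with exponents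
  \<open>\<ge> g\<close> are harmless. If all exponents of \<open>\<sigma> \<noteq> 0\<close> are below \<open>g\<close>, consuming \<open>\<sigma>\<close> first leads to an
  index \<open>z \<ge> i + norm \<sigma>\<close>. At such a late index \<open>\<omega>\<^sup>g\<close> dominates \<open>\<omega>\<^bsup>p+1\<^esup>\<close>, where \<open>p\<close> is the largest
  exponent of \<open>\<sigma> \<oplus> {\<omega>\<^sup>g}(s i)\<close>, and the next step gives \<open>s z\<close> copies of \<open>\<omega>\<^sup>p\<close>, which outnumber and
  dominate all terms of \<open>\<sigma> \<oplus> {\<omega>\<^sup>g}(s i)\<close>.
\<close>

section \<open>Ordinals as multisets of exponents\<close>

lemma is_cnf_Rep: "is_cnf (Rep_eps0 a)"
  using Rep_eps0[of a] by simp

lemma eps0_zero_le [simp]: "(0::eps0) \<le> a"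
proof transfer
  fix a show "CNF [] \<le> a"
    by (cases a rule: cnf.exhaust) (metis cnf.exhaust less_cnf_simps(1) not_le)
qed

lemma eps0_le_zero_iff [simp]: "a \<le> 0 \<longleftrightarrow> a = (0::eps0)"
  by (simp add: order.antisym order_eq_iff)

definition exponents :: "eps0 \<Rightarrow> eps0 multiset" where
  "exponents a = mset (map Abs_eps0 (exps (Rep_eps0 a)))"

text \<open>Inverse to \<open>exponents\<close>; the reversal restores the non-increasing order.
  Through this pair a natural sum becomes a multiset union.\<close>

definition omega_sum :: "eps0 multiset \<Rightarrow> eps0" where
  "omega_sum M = Abs_eps0 (CNF (map Rep_eps0 (rev (sorted_list_of_multiset M))))"

lemma exps_RepE:
  obtains xs where "Rep_eps0 a = CNF (map Rep_eps0 xs)" "sorted_wrt (\<ge>) xs" "exponents a = mset xs"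
proof -
  obtain ys where ys: "Rep_eps0 a = CNF ys" by (cases "Rep_eps0 a")
  have c: "sorted_wrt (\<ge>) ys" "\<forall>y\<in>set ys. is_cnf y"
    using is_cnf_Rep[of a] ys by simp_all
  have m: "map Rep_eps0 (map Abs_eps0 ys) = ys"
    using c(2) by (simp add: map_idI Abs_eps0_inverse)
  have "sorted_wrt (\<ge>) (map Rep_eps0 (map Abs_eps0 ys))" using c m by simp
  then have "sorted_wrt (\<ge>) (map Abs_eps0 ys)"
    by (simp only: sorted_wrt_map less_eq_eps0.rep_eq)
  with that[of "map Abs_eps0 ys"] m ys show ?thesis by (simp add: exponents_def)
qed

lemma exponents_omega_sum [simp]: "exponents (omega_sum M) = M"
proof -
  let ?xs = "rev (sorted_list_of_multiset M)"
  have "sorted_wrt (\<ge>) ?xs" by (simp add: sorted_wrt_rev)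
  then have "is_cnf (CNF (map Rep_eps0 ?xs))"
    by (auto simp: sorted_wrt_map less_eq_eps0.rep_eq is_cnf_Rep simp del: sorted_wrt_rev)
  then have "Rep_eps0 (omega_sum M) = CNF (map Rep_eps0 ?xs)"
    by (simp add: omega_sum_def Abs_eps0_inverse)
  then show ?thesis by (simp add: exponents_def Rep_eps0_inverse o_def)
qed

lemma exponents_inject [simp]: "exponents a = exponents b \<longleftrightarrow> a = b"
proof
  assume e: "exponents a = exponents b"
  obtain xs where xs: "Rep_eps0 a = CNF (map Rep_eps0 xs)" "sorted_wrt (\<ge>) xs" "exponents a = mset xs"
    by (rule exps_RepE)
  obtain ys where ys: "Rep_eps0 b = CNF (map Rep_eps0 ys)" "sorted_wrt (\<ge>) ys" "exponents b = mset ys"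
    by (rule exps_RepE)
  have "sorted (rev xs)" "sorted (rev ys)" "mset (rev xs) = mset (rev ys)"
    using xs ys e by (simp_all add: sorted_wrt_rev)
  then have "rev xs = rev ys" by (metis properties_for_sort)
  with xs ys show "a = b" by (simp flip: Rep_eps0_inject)
qed simp

lemma omega_sum_exponents [simp]: "omega_sum (exponents a) = a"
  by (simp flip: exponents_inject)

lemma exponents_zero [simp]: "exponents 0 = {#}"
  by (simp add: exponents_def zero_eps0.rep_eq)

lemma exponents_eq_empty_iff [simp]: "exponents a = {#} \<longleftrightarrow> a = 0"
  by (metis exponents_inject exponents_zero)

lemma omega_sum_empty [simp]: "omega_sum {#} = 0"
  by (simp flip: exponents_inject)

lemma omega_sum_eq_0_iff [simp]: "omega_sum M = 0 \<longleftrightarrow> M = {#}"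
  by (simp flip: exponents_inject)

lemma exponents_natural_sum: "exponents (a \<oplus> b) = exponents a + exponents b"
  by (simp add: exponents_def natural_sum.rep_eq)

lemma natural_sum_omega_sum: "a \<oplus> b = omega_sum (exponents a + exponents b)"
  by (simp flip: exponents_inject add: exponents_natural_sum)

section \<open>The order in terms of exponent counts\<close>

lemma less_imp_pivot:
  assumes "sorted_wrt (\<ge>) xs" "sorted_wrt (\<ge>) ys"
    and "CNF (map Rep_eps0 xs) < CNF (map Rep_eps0 ys)"
  shows "\<exists>g. count (mset xs) g < count (mset ys) g \<and> (\<forall>e>g. count (mset xs) e = count (mset ys) e)"
  using assms
proof (induction xs arbitrary: ys)
  case Nil
  then obtain y zs where ys: "ys = y # zs" by (cases ys) auto
  with Nil show ?case
    by (intro exI[of _ y]) (auto simp: not_in_iff[symmetric] leD)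
next
  case (Cons x xs)
  then obtain y zs where ys: "ys = y # zs" by (cases ys) auto
  show ?case
  proof (cases "x = y")
    case True
    then obtain g where "count (mset xs) g < count (mset zs) g"
      "\<forall>e>g. count (mset xs) e = count (mset zs) e"
      using Cons.IH[of zs] Cons.prems ys by auto
    with True ys show ?thesis by (intro exI[of _ g]) auto
  next
    case False
    \<comment> \<open>From the first difference on, all entries of the smaller list lie below
      \<open>y\<close> and none of the larger list exceeds \<open>y\<close>, so \<open>y\<close> is
      the pivot.\<close>
    then have "x < y" using Cons.prems ys by (simp add: Rep_eps0_inject less_eps0.rep_eq)
    moreover have "\<forall>e\<in>set xs. e \<le> x" "\<forall>e\<in>set zs. e \<le> y" using Cons.prems ys by auto
    ultimately have "\<forall>e\<ge>y. count (mset xs) e = 0" "\<forall>e>y. count (mset zs) e = 0"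
      by auto
    with \<open>x < y\<close> ys show ?thesis
      by (intro exI[of _ y]) (auto simp del: count_mset_0_iff)
  qed
qed

text \<open>The converse uses totality: pivots in both directions contradict each other at the
  larger one.\<close>

lemma less_iff_pivot:
  "a < b \<longleftrightarrow> (\<exists>g. count (exponents a) g < count (exponents b) g \<and>
      (\<forall>e>g. count (exponents a) e = count (exponents b) e))" (is "_ \<longleftrightarrow> ?P a b")
proof
  have imp: "?P a b" if "a < b" for a b
  proof -
    obtain xs where xs: "Rep_eps0 a = CNF (map Rep_eps0 xs)" "sorted_wrt (\<ge>) xs" "exponents a = mset xs"
      by (rule exps_RepE)
    obtain ys where ys: "Rep_eps0 b = CNF (map Rep_eps0 ys)" "sorted_wrt (\<ge>) ys" "exponents b = mset ys"
      by (rule exps_RepE)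
    from less_imp_pivot[OF xs(2) ys(2)] that xs ys show ?thesis
      by (simp add: less_eps0.rep_eq)
  qed
  show "a < b \<Longrightarrow> ?P a b" by (rule imp)
  assume P: "?P a b"
  show "a < b"
  proof (rule ccontr)
    assume "\<not> a < b"
    moreover have "a \<noteq> b" using P by auto
    ultimately have "?P b a" using imp[of b a] by simp
    with P show False by (metis less_asym linorder_cases less_irrefl)
  qed
qed

lemma lessI_pivot:
  assumes "count (exponents a) g < count (exponents b) g"
    and "\<And>e. e > g \<Longrightarrow> count (exponents a) e = count (exponents b) e"
  shows "a < b"
  using assms less_iff_pivot by blast

lemma omega_sum_le_union: "omega_sum M \<le> omega_sum (M + N)"
proof (cases "N = {#}")
  case False
  define g where "g = Max (set_mset N)"
  have g: "g \<in># N" "\<forall>e\<in>#N. e \<le> g" using False by (simp_all add: g_def)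
  then have "omega_sum M < omega_sum (M + N)"
    by (intro lessI_pivot[of _ g]) (auto simp: count_eq_zero_iff leD)
  then show ?thesis by simp
qed simp

lemma omega_sum_less_union:
  assumes "\<forall>e\<in>#N. e < g"
  shows "omega_sum (M + N) < omega_sum (add_mset g M)"
  by (rule lessI_pivot[of _ g]) (use assms in \<open>auto simp: count_eq_zero_iff\<close>)

lemma omega_sum_union_less_iff [simp]:
  "omega_sum (D + M) < omega_sum (D + N) \<longleftrightarrow> omega_sum M < omega_sum N"
  using less_iff_pivot[of "omega_sum M" "omega_sum N"]
    less_iff_pivot[of "omega_sum (D + M)" "omega_sum (D + N)"] by simp

lemma omega_sum_union_le_iff [simp]:
  "omega_sum (D + M) \<le> omega_sum (D + N) \<longleftrightarrow> omega_sum M \<le> omega_sum N"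
  by (simp flip: not_less)

lemma omega_sum_lessI: "\<forall>e\<in>#N. e < g \<Longrightarrow> omega_sum N < omega_sum {#g#}"
  using omega_sum_less_union[of N g "{#}"] by simp

text \<open>The pivot is at least \<open>g\<close>, since the right side has no exponent below
  \<open>g\<close>. Either \<open>a\<close> already falls short of \<open>D\<close> there, or only
  the extra copy of \<open>g\<close> is missing and everything after \<open>D\<close> has exponents
  below \<open>g\<close>.\<close>

lemma less_omega_sum_add_mset:
  assumes less: "a < omega_sum (add_mset g D)" and D: "\<forall>e\<in>#D. g \<le> e"
  obtains "a < omega_sum D" | R where "a = omega_sum (D + R)" "\<forall>r\<in>#R. r < g"
proof -
  obtain q where q: "count (exponents a) q < count (add_mset g D) q"
    and above: "\<And>e. e > q \<Longrightarrow> count (exponents a) e = count (add_mset g D) e"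
    using less_iff_pivot[of a "omega_sum (add_mset g D)"] less
    unfolding exponents_omega_sum by blast
  have "g \<le> q"
  proof (rule ccontr)
    assume "\<not> g \<le> q"
    then have "q \<notin># add_mset g D" using D by auto
    with q show False unfolding not_in_iff by simp
  qed
  show ?thesis
  proof (cases "count (exponents a) q < count D q")
    case True
    have "a < omega_sum D"
      by (rule lessI_pivot[of _ q]) (use True above \<open>g \<le> q\<close> in auto)
    then show ?thesis by (rule that(1))
  next
    case False
    with q have q_eq: "q = g" "count (exponents a) g = count D g" by (auto split: if_splits)
    define R where "R = filter_mset (\<lambda>e. e < g) (exponents a)"
    have "exponents a = D + R"
    proof (rule multiset_eqI)
      fix e
      consider "e < g" | "e = g" | "e > g" by (rule linorder_cases)
      then show "count (exponents a) e = count (D + R) e"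
      proof cases
        case 1
        then have "e \<notin># D" using D by auto
        with 1 show ?thesis by (simp add: R_def not_in_iff)
      qed (use q_eq above in \<open>auto simp: R_def\<close>)
    qed
    then show ?thesis
      by (intro that(2)[of R]) (auto simp: R_def simp flip: exponents_inject)
  qed
qed

lemma eps0_minE:
  obtains "a = 0" | g D where "a = omega_sum (add_mset g D)" "\<forall>e\<in>#D. g \<le> e"
proof (cases "a = 0")
  case False
  define g where "g = Min (set_mset (exponents a))"
  have "g \<in># exponents a" "\<forall>e\<in>#exponents a. g \<le> e"
    using False by (simp_all add: g_def)
  then show ?thesis
    using that(2)[of g "exponents a - {#g#}"] by (auto dest: in_diffD)
qed

section \<open>Fundamental sequences and norms\<close>

definition successor :: "eps0 \<Rightarrow> eps0" where
  "successor p = omega_sum (add_mset 0 (exponents p))"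

definition is_limit :: "eps0 \<Rightarrow> bool" where
  "is_limit a \<longleftrightarrow> a \<noteq> 0 \<and> 0 \<notin># exponents a"

lemma eps0_cases:
  obtains "a = 0" | p where "a = successor p" | "is_limit a"
proof (cases "0 \<in># exponents a")
  case True
  then have "a = successor (omega_sum (exponents a - {#0#}))"
    by (simp add: successor_def)
  then show ?thesis by (rule that(2))
qed (use that in \<open>auto simp: is_limit_def\<close>)

lemma successor_not_zero [simp]: "successor p \<noteq> 0"
  by (simp add: successor_def)

lemma less_successor_iff: "e < successor p \<longleftrightarrow> e \<le> p"
proof
  assume "e < successor p"
  then show "e \<le> p"
    unfolding successor_def
    by (rule less_omega_sum_add_mset) (auto simp: leD)
next
  have "p < successor p"
    using omega_sum_less_union[of "{#}" 0 "exponents p"] by (simp add: successor_def)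
  then show "e \<le> p \<Longrightarrow> e < successor p" by simp
qed

lemma successor_le_iff: "successor p \<le> a \<longleftrightarrow> p < a"
  by (metis less_successor_iff not_le)

text \<open>The exponents that replace a last term \<omega>^g in a fundamental step. Naming them
  separately allows the same replacement where \<omega>^g is not the last term of a natural
  sum.\<close>

definition fund_terms :: "eps0 \<Rightarrow> nat \<Rightarrow> eps0 multiset" where
  "fund_terms g n = exponents (fund_seq (omega_sum {#g#}) n)"

lemma exponents_Abs_CNF: "is_cnf (CNF ys) \<Longrightarrow> exponents (Abs_eps0 (CNF ys)) = mset (map Abs_eps0 ys)"
  by (simp add: exponents_def Abs_eps0_inverse)

lemma exponents_fund_seq:
  assumes a: "exponents a = add_mset g D" and D: "\<forall>e\<in>#D. g \<le> e"
  shows "exponents (fund_seq a n) = D + (if g = 0 then {#}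
    else if 0 \<in># exponents g then replicate_mset n (omega_sum (exponents g - {#0#}))
    else {#fund_seq g n#})"
proof -
  \<comment> \<open>A least exponent sits at the end of a non-increasing list. This is applied to
    \<open>a\<close>, and to a successor \<open>g\<close>, whose least exponent is 0.\<close>
  have last: "\<exists>ys. exps (Rep_eps0 b) = map Rep_eps0 ys @ [Rep_eps0 f] \<and> mset ys = E"
    if b: "exponents b = add_mset f E" and E: "\<forall>e\<in>#E. f \<le> e" for b f E
  proof -
    obtain xs where xs: "Rep_eps0 b = CNF (map Rep_eps0 xs)" "sorted_wrt (\<ge>) xs" "exponents b = mset xs"
      by (rule exps_RepE)
    then have "xs \<noteq> []" using b by auto
    then obtain ys y where ys: "xs = ys @ [y]" by (metis append_butlast_last_id)
    have "\<forall>e\<in>#add_mset f E. y \<le> e" "y \<in># add_mset f E"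
      using xs ys by (auto simp: sorted_wrt_append simp flip: b)
    with E have "y = f" by force
    then show ?thesis using xs ys b by auto
  qed
  obtain ys where ys: "exps (Rep_eps0 a) = map Rep_eps0 ys @ [Rep_eps0 g]" "mset ys = D"
    using last[OF a D] by blast
  have RA: "Rep_eps0 a = CNF (map Rep_eps0 ys @ [Rep_eps0 g])" using ys(1) by (metis cnf.collapse)
  have g0: "exps (Rep_eps0 g) = [] \<longleftrightarrow> g = 0"
    by (metis cnf.collapse cnf.sel Rep_eps0_inject zero_eps0.rep_eq)
  have e: "exponents (fund_seq a n) = mset (map Abs_eps0 (exps (cnf_fund (Rep_eps0 a) n)))"
    by (simp add: exponents_def fund_seq.rep_eq)
  have AR: "Abs_eps0 \<circ> Rep_eps0 = id" by (auto simp: Rep_eps0_inverse)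
  consider "g = 0" | "g \<noteq> 0" "0 \<in># exponents g" | "g \<noteq> 0" "0 \<notin># exponents g" by blast
  then show ?thesis
  proof cases
    case 1
    then show ?thesis
      using ys g0 by (simp add: e RA cnf_fund.simps AR)
  next
    case 2
    then obtain zs where zs: "exps (Rep_eps0 g) = map Rep_eps0 zs @ [Rep_eps0 0]"
      "mset zs = exponents g - {#0#}"
      using last[of g 0 "exponents g - {#0#}"] by auto
    have "Rep_eps0 g = CNF (map Rep_eps0 zs @ [CNF []])"
      using zs(1) by (metis cnf.collapse zero_eps0.rep_eq)
    then have c: "is_cnf (CNF (map Rep_eps0 zs))"
      using is_cnf_Rep[of g] by (auto simp: sorted_wrt_append)
    have p: "Abs_eps0 (CNF (map Rep_eps0 zs)) = omega_sum (exponents g - {#0#})"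
      using exponents_Abs_CNF[OF c] zs(2) by (simp add: AR flip: exponents_inject)
    show ?thesis
      using 2 ys(2) g0 zs(1) p by (simp add: e RA cnf_fund.simps AR zero_eps0.rep_eq Let_def)
  next
    case 3
    then have ne: "exps (Rep_eps0 g) \<noteq> []" using g0 by simp
    have "last (exps (Rep_eps0 g)) \<noteq> CNF []"
    proof
      assume "last (exps (Rep_eps0 g)) = CNF []"
      then have "CNF [] \<in> set (exps (Rep_eps0 g))" using ne by (metis last_in_set)
      then have "Abs_eps0 (CNF []) \<in># exponents g" by (auto simp: exponents_def)
      then show False using 3 by (simp add: zero_eps0_def)
    qed
    then have "cnf_fund (Rep_eps0 a) n = CNF (map Rep_eps0 ys @ [cnf_fund (Rep_eps0 g) n])"
      using ne by (subst RA, subst cnf_fund.simps) (simp add: Let_def)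
    then show ?thesis
      using 3 ys(2) by (simp add: e AR Rep_eps0_inverse flip: fund_seq.rep_eq)
  qed
qed

lemma fund_terms_zero [simp]: "fund_terms 0 n = {#}"
  by (simp add: fund_terms_def exponents_fund_seq)

lemma fund_terms_successor [simp]: "fund_terms (successor p) n = replicate_mset n p"
  using exponents_fund_seq[of "omega_sum {#successor p#}" "successor p" "{#}"]
  by (simp add: fund_terms_def) (simp add: successor_def)

lemma fund_terms_limit [simp]: "is_limit g \<Longrightarrow> fund_terms g n = {#fund_seq g n#}"
  using exponents_fund_seq[of "omega_sum {#g#}" g "{#}"]
  by (simp add: fund_terms_def is_limit_def)

lemma fund_seq_omega_sum:
  assumes "\<forall>e\<in>#D. g \<le> e"
  shows "fund_seq (omega_sum (add_mset g D)) n = omega_sum (D + fund_terms g n)"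
proof -
  have "exponents (fund_seq (omega_sum (add_mset g D)) n) = D + fund_terms g n"
    unfolding fund_terms_def exponents_fund_seq[OF exponents_omega_sum assms]
      exponents_fund_seq[of "omega_sum {#g#}" g "{#}" n, simplified] by simp
  then show ?thesis by (metis omega_sum_exponents)
qed

lemma fund_terms_less: "f \<in># fund_terms g n \<Longrightarrow> f < g"
  by (cases g rule: eps0_cases)
    (auto simp: less_successor_iff is_limit_def intro: fund_seq_less split: if_splits)

section \<open>The norm, counting occurrences of \<omega> in the hereditary normal form\<close>

fun cnf_norm :: "cnf \<Rightarrow> nat" where
  "cnf_norm (CNF xs) = (\<Sum>x\<leftarrow>xs. Suc (cnf_norm x))"

definition norm :: "eps0 \<Rightarrow> nat" where
  "norm a = cnf_norm (Rep_eps0 a)"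

lemma norm_omega_sum: "norm (omega_sum M) = (\<Sum>e\<in>#M. Suc (norm e))"
proof -
  obtain xs where xs: "Rep_eps0 (omega_sum M) = CNF (map Rep_eps0 xs)" "exponents (omega_sum M) = mset xs"
    by (rule exps_RepE)
  then show ?thesis
    by (simp add: norm_def o_def flip: sum_mset_sum_list)
qed

lemma norm_union [simp]: "norm (omega_sum (M + N)) = norm (omega_sum M) + norm (omega_sum N)"
  by (simp add: norm_omega_sum)

lemma norm_add_mset [simp]: "norm (omega_sum (add_mset g M)) = Suc (norm g) + norm (omega_sum M)"
  by (simp add: norm_omega_sum)

lemma norm_zero [simp]: "norm 0 = 0"
  using norm_omega_sum[of "{#}"] by simp

lemma norm_successor [simp]: "norm (successor p) = Suc (norm p)"
  by (simp add: successor_def)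

lemma norm_exponent: "e \<in># M \<Longrightarrow> norm e < norm (omega_sum M)"
  by (auto dest!: multi_member_split)

lemma size_le_norm: "size M \<le> norm (omega_sum M)"
  by (induction M) auto

text \<open>A step loses at most one \<omega>: for \<omega>^(p+1) the exponent loses one and at
  least one copy of \<omega>^p survives, as \<open>n > 0\<close>; for a limit exponent the loss
  occurs inside it.\<close>

lemma norm_le_fund_seq: "n > 0 \<Longrightarrow> norm a \<le> Suc (norm (fund_seq a n))"
proof (induction a rule: measure_induct_rule[of norm])
  case (less a)
  show ?case
  proof (cases a rule: eps0_minE)
    case (2 g D)
    have "Suc (norm g) \<le> Suc (norm (omega_sum (fund_terms g n)))"
    proof (cases g rule: eps0_cases)
      case (2 p)
      with less.prems show ?thesis by (cases n) (auto simp: norm_omega_sum)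
    next
      case 3
      with less.IH[of g] less.prems \<open>a = _\<close> show ?thesis by simp
    qed simp
    with 2 show ?thesis by (simp add: fund_seq_omega_sum)
  qed simp
qed

lemma fund_seq_strict_mono:
  assumes "is_limit a" "m < n"
  shows "fund_seq a m < fund_seq a n"
  using assms(1)
proof (induction a rule: measure_induct_rule[of norm])
  case (less a)
  show ?case
  proof (cases a rule: eps0_minE)
    case (2 g D)
    have "omega_sum (fund_terms g m) < omega_sum (fund_terms g n)"
    proof (cases g rule: eps0_cases)
      case 1
      with 2 less.prems show ?thesis by (simp add: is_limit_def)
    next
      case (2 p)
      with \<open>m < n\<close> show ?thesis by (auto intro: lessI_pivot[of _ p])
    next
      case 3
      then have "fund_seq g m < fund_seq g n" using less.IH[of g] 2 by simp
      with 3 show ?thesis by (simp add: omega_sum_lessI)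
    qed
    with 2 show ?thesis by (simp add: fund_seq_omega_sum)
  qed (use less.prems in \<open>simp add: is_limit_def\<close>)
qed

lemma fund_seq_successor [simp]: "fund_seq (successor p) n = p"
  by (simp add: successor_def fund_seq_omega_sum)

lemma fund_seq_mono: "m \<le> n \<Longrightarrow> fund_seq a m \<le> fund_seq a n"
  by (cases a rule: eps0_cases) (auto simp: order_le_less fund_seq_strict_mono)

text \<open>Only the tail \<open>R\<close> of \<open>a\<close> beyond the common part
  \<open>D\<close> matters. For \<open>g\<close> = p+1 it has at most \<open>n\<close> terms, none
  above \<omega>^p; for a limit \<open>g\<close> its exponents have small norm and are bounded by
  induction.\<close>

lemma le_fund_seq_of_norm_le:
  assumes "a < b" "norm a \<le> n"
  shows "a \<le> fund_seq b n"
  using assms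
proof (induction b arbitrary: a n rule: measure_induct_rule[of norm])
  case (less b)
  show ?case
  proof (cases b rule: eps0_minE)
    case 1
    with less.prems show ?thesis by (simp add: leD)
  next
    case (2 g D)
    have "omega_sum D \<le> fund_seq b n"
      using 2 by (simp add: fund_seq_omega_sum omega_sum_le_union)
    moreover have "a \<le> fund_seq b n" if a: "a = omega_sum (D + R)" and R: "\<forall>r\<in>#R. r < g" for R
    proof -
      have n: "norm (omega_sum R) \<le> n" using a less.prems(2) by simp
      have "omega_sum R \<le> omega_sum (fund_terms g n)"
      proof (cases g rule: eps0_cases)
        case 1
        with R have "R = {#}" by (metis eps0_zero_le leD multiset_nonemptyE)
        then show ?thesis by simp
      next
        case (2 p)
        with R have p: "\<forall>r\<in>#R. r \<le> p" by (simp add: less_successor_iff)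
        have "size R \<le> n" using size_le_norm[of R] n by simp
        show ?thesis
        proof (cases "count R p < n")
          case True
          have "omega_sum R < omega_sum (replicate_mset n p)"
            by (rule lessI_pivot[of _ p]) (use True p in \<open>auto simp: count_eq_zero_iff leD\<close>)
          with 2 show ?thesis by simp
        next
          case False
          then have sub: "replicate_mset n p \<subseteq># R" by (simp flip: count_le_replicate_mset_subset_eq)
          have "R = replicate_mset n p"
            using sub \<open>size R \<le> n\<close>
            by (metis mset_subset_size not_less size_replicate_mset subset_mset.le_less)
          with 2 show ?thesis by simp
        qed
      next
        case 3
        have "r < fund_seq g n" if "r \<in># R" for r
        proof -
          have "norm r < n" using norm_exponent[OF that] n by simp
          \<comment> \<open>The norm of \<open>r\<close> is strictly below \<open>n\<close>; the
            spare unit turns \<le> at \<open>n - 1\<close> into < at \<open>n\<close>, so all of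
            \<open>R\<close> lies below a single power.\<close>
          then have "r \<le> fund_seq g (n - 1)" using less.IH[of g r "n - 1"] 2 R that by simp
          also have "\<dots> < fund_seq g n" by (rule fund_seq_strict_mono) (use 3 \<open>norm r < n\<close> in auto)
          finally show ?thesis .
        qed
        with 3 show ?thesis by (simp add: omega_sum_lessI less_imp_le)
      qed
      with 2 a show ?thesis by (simp add: fund_seq_omega_sum)
    qed
    ultimately show ?thesis
      using less_omega_sum_add_mset[of a g D "a \<le> fund_seq b n"] less.prems(1) 2 by fastforce
  qed
qed

section \<open>Iterated fundamental sequences\<close>

text \<open>\<open>steps\<close> is not monotone for \<open><\<close>: a large finite ordinal can
  outlast \<omega>. It is monotone along these descents with parameter \<open>s i\<close>, which
  therefore take the place of \<open><\<close>.\<close>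

inductive reach :: "nat \<Rightarrow> eps0 \<Rightarrow> eps0 \<Rightarrow> bool" for n where
  refl [simp]: "reach n a a"
| step: "reach n (fund_seq a n) b \<Longrightarrow> reach n a b"

lemma reach_trans: "reach n a b \<Longrightarrow> reach n b c \<Longrightarrow> reach n a c"
  by (induction rule: reach.induct) (auto intro: reach.step)

lemma reach_fund_seq: "reach n a (fund_seq a n)"
  by (rule reach.step) simp

lemma reach_from_zero: "reach n 0 b \<Longrightarrow> b = 0"
  by (induction "0::eps0" b rule: reach.induct) simp_all

lemma reach_zero: "reach n a 0"
proof (induction a rule: less_induct)
  case (less a)
  then show ?case by (cases "a = 0") (simp, rule reach.step, simp add: fund_seq_less)
qed

text \<open>A step only creates exponents smaller than the one it replaces, so the descent stays in
  the tail and never touches \<open>D\<close>.\<close>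

lemma reach_omega_sum_union:
  assumes "reach n b c" and "\<forall>e\<in>#D. \<forall>f\<in>#exponents b. f \<le> e"
  shows "reach n (omega_sum (D + exponents b)) (omega_sum (D + exponents c))"
  using assms
proof (induction rule: reach.induct)
  case (step b c)
  show ?case
  proof (cases b rule: eps0_minE)
    case 1
    with step show ?thesis by simp
  next
    case (2 g B)
    have fs: "exponents (fund_seq b n) = B + fund_terms g n" using 2 by (simp add: fund_seq_omega_sum)
    have "\<forall>e\<in>#D. \<forall>f\<in>#exponents (fund_seq b n). f \<le> e"
      using step.prems 2 unfolding fs by (fastforce dest: fund_terms_less)
    moreover have "fund_seq (omega_sum (D + exponents b)) n = omega_sum (D + exponents (fund_seq b n))"
      using fund_seq_omega_sum[of "D + B" g n] 2 step.prems unfolding fs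
      by (auto simp: add.assoc)
    ultimately show ?thesis using step.IH by (metis reach.step)
  qed
qed simp

lemma reach_omega_sum_drop:
  assumes "\<forall>e\<in>#D. \<forall>f\<in>#B. f \<le> e"
  shows "reach n (omega_sum (D + B)) (omega_sum D)"
  using reach_omega_sum_union[OF reach_zero[of n "omega_sum B"]] assms by simp

text \<open>A step in the exponent is imitated one level up: a successor exponent p+1 yields
  \<open>n\<close> copies of \<omega>^p, of which all but one are dropped; a limit exponent needs a
  single step.\<close>

lemma reach_omega_power:
  assumes "reach n a b" "n > 0"
  shows "reach n (omega_sum {#a#}) (omega_sum {#b#})"
  using assms(1)
proof (induction rule: reach.induct)
  case (step a b)
  have "reach n (omega_sum {#a#}) (omega_sum {#fund_seq a n#})"
  proof (cases a rule: eps0_cases)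
    case (2 p)
    obtain k where "n = Suc k" using \<open>n > 0\<close> by (cases n) auto
    then show ?thesis
      using reach_omega_sum_drop[of "{#p#}" "replicate_mset k p" n] 2
      by (intro reach.step[of n "omega_sum {#a#}"]) (auto simp: fund_seq_omega_sum split: if_splits)
  next
    case 3
    then show ?thesis
      using reach_fund_seq[of n "omega_sum {#a#}"] by (simp add: fund_seq_omega_sum)
  qed simp
  then show ?case using step.IH by (rule reach_trans)
qed simp

text \<open>The Bachmann property of these fundamental sequences. The bounds on \<open>t\<close> fix
  its leading part \<open>D\<close>, so only a tail has to descend. Since \<open>k\<close> is any
  positive parameter, parameters can later be changed.\<close>

lemma bachmann_property:
  assumes "k > 0" "fund_seq c m \<le> t" "t < c"
  shows "reach k t (fund_seq c m)"
  using assms(2,3)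
proof (induction c arbitrary: t rule: measure_induct_rule[of norm])
  case (less c)
  show ?case
  proof (cases c rule: eps0_minE)
    case 1
    with less.prems show ?thesis by (simp add: leD)
  next
    case (2 g D)
    have fs: "fund_seq c m = omega_sum (D + fund_terms g m)" using 2 by (simp add: fund_seq_omega_sum)
    have "\<not> t < omega_sum D"
      using less.prems(1) omega_sum_le_union[of D "fund_terms g m"] unfolding fs by simp
    then obtain R where t: "t = omega_sum (D + R)" and R: "\<forall>r\<in>#R. r < g"
      using less_omega_sum_add_mset[of t g D thesis] less.prems(2) 2 by blast
    have le: "omega_sum (fund_terms g m) \<le> omega_sum R" using less.prems(1) unfolding fs t by simp
    have "reach k (omega_sum R) (omega_sum (fund_terms g m))"
    proof (cases g rule: eps0_cases)
      case 1
      then show ?thesis by (simp add: reach_zero)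
    next
      case (2 p)
      with R have p: "\<forall>r\<in>#R. r \<le> p" by (simp add: less_successor_iff)
      have "\<not> count R p < m"
      proof
        assume "count R p < m"
        then have "omega_sum R < omega_sum (replicate_mset m p)"
          by (intro lessI_pivot[of _ p]) (use p in \<open>auto simp: count_eq_zero_iff leD\<close>)
        with le 2 show False by simp
      qed
      then have "replicate_mset m p \<subseteq># R" by (simp flip: count_le_replicate_mset_subset_eq)
      then obtain R' where "R = replicate_mset m p + R'" by (metis subset_mset.add_diff_inverse)
      with p 2 show ?thesis by (auto intro!: reach_omega_sum_drop simp: reach_zero split: if_splits)
    next
      case 3
      then have "R \<noteq> {#}" using le by auto
      \<comment> \<open>The largest exponent of \<open>R\<close> lies between
        \<open>fund_seq g m\<close> and \<open>g\<close>, so the induction hypothesis applies to it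
        once the other terms of \<open>R\<close> are dropped.\<close>
      define e where "e = Max (set_mset R)"
      have e: "e \<in># R" "\<forall>r\<in>#R. r \<le> e" using \<open>R \<noteq> {#}\<close> by (simp_all add: e_def)
      have "fund_seq g m \<le> e"
      proof (rule ccontr)
        assume "\<not> ?thesis"
        then have "omega_sum R < omega_sum {#fund_seq g m#}"
          using e by (intro omega_sum_lessI) force
        with le 3 show False by simp
      qed
      then have "reach k e (fund_seq g m)" using less.IH[of g e] 2 R e by simp
      then have "reach k (omega_sum {#e#}) (omega_sum (fund_terms g m))"
        using 3 \<open>k > 0\<close> by (simp add: reach_omega_power)
      moreover obtain R' where "R = {#e#} + R'" using e(1) by (metis multi_member_split add_mset_add_single union_commute)
      ultimately show ?thesis
        using reach_omega_sum_drop[of "{#e#}" R' k] e by (auto intro: reach_trans)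
    qed
    then show ?thesis
      using reach_omega_sum_union[of k "omega_sum R" _ D] R 2 unfolding t fs by force
  qed
qed

lemma reach_fund_seq_mono: "k > 0 \<Longrightarrow> m \<le> n \<Longrightarrow> reach k (fund_seq a n) (fund_seq a m)"
  by (cases "a = 0") (auto intro!: bachmann_property fund_seq_mono fund_seq_less)

text \<open>A step with parameter \<open>m\<close> is imitated by one with \<open>n\<close> followed
  by a descent from \<open>fund_seq a n\<close> to \<open>fund_seq a m\<close>.\<close>

lemma reach_mono:
  assumes "reach m a b" "0 < m" "m \<le> n"
  shows "reach n a b"
  using assms(1)
proof (induction rule: reach.induct)
  case (step a b)
  then show ?case
    using reach_trans[OF reach.step[OF reach_fund_seq_mono[of n m n a]]] assms(2,3) by simp
qed simp

text \<open>A descent with parameter \<open>n\<close> cannot jump over an ordinal of norm at most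
  \<open>n\<close>.\<close>

lemma reach_norm:
  assumes "a \<le> b" "norm a \<le> n"
  shows "reach n b a"
  using assms(1)
proof (induction b rule: less_induct)
  case (less b)
  show ?case
  proof (cases "a = b")
    case False
    then have "a < b" using less.prems by simp
    moreover from this have "b \<noteq> 0" by (auto simp: leD)
    ultimately show ?thesis
      using less.IH[OF fund_seq_less] le_fund_seq_of_norm_le assms(2) by (intro reach.step[of n b]) auto
  qed simp
qed

text \<open>Yields p+1 where no norm bound is at hand. If parameter 1 jumps from a limit straight to
  \<open>b\<close>, the value at 2 is still strictly above \<open>b\<close>, and induction applies
  to it.\<close>

lemma reach_successor:
  assumes "reach 1 a b" "a \<noteq> b"
  shows "reach 2 a (successor b)"
  using assms
proof (induction a rule: less_induct)
  case (less a)
  have a: "a \<noteq> 0" and r: "reach 1 (fund_seq a 1) b"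
    using less.prems by (auto dest: reach_from_zero elim: reach.cases)
  show ?case
  proof (cases "fund_seq a 1 = b")
    case False
    have "reach 2 (fund_seq a 1) (successor b)"
      using less.IH[OF fund_seq_less[OF a] r False] .
    moreover have "reach 2 a (fund_seq a 1)"
      by (rule reach.step, rule reach_fund_seq_mono) auto
    ultimately show ?thesis by (metis reach_trans)
  next
    case True
    show ?thesis
    proof (cases a rule: eps0_cases)
      case 1
      with a show ?thesis by simp
    next
      case (2 p)
      with True show ?thesis by simp
    next
      case 3
      have "fund_seq a 1 < fund_seq a 2" by (rule fund_seq_strict_mono[OF 3]) simp
      moreover have "reach 1 (fund_seq a 2) b"
        using reach_fund_seq_mono[of 1 1 2 a] True by simp
      ultimately show ?thesis
        using less.IH[OF fund_seq_less[OF a]] True by (intro reach.step[of 2 a]) auto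
    qed
  qed
qed

section \<open>Length of the descent along a sequence\<close>

function steps :: "(nat \<Rightarrow> nat) \<Rightarrow> eps0 \<Rightarrow> nat \<Rightarrow> nat" where
  "steps s a i = (if a = 0 then i else steps s (fund_seq a (s i)) (Suc i))"
  by pat_completeness auto
termination
  by (relation "inv_image {(a, b). a < b} (\<lambda>(s, a, i). a)")
    (auto simp: fund_seq_less wf intro: wf_inv_image)

declare steps.simps [simp del]

lemma steps_zero [simp]: "steps s 0 i = i"
  by (simp add: steps.simps)

lemma steps_nonzero: "a \<noteq> 0 \<Longrightarrow> steps s a i = steps s (fund_seq a (s i)) (Suc i)"
  by (subst steps.simps) simp

text \<open>The descent works on the final terms \<open>B\<close> alone and turns to
  \<open>D\<close> at the index where \<open>B\<close> has vanished.\<close>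

lemma steps_union:
  assumes "\<forall>e\<in>#D. \<forall>f\<in>#B. f \<le> e"
  shows "steps s (omega_sum (D + B)) i = steps s (omega_sum D) (steps s (omega_sum B) i)"
proof -
  have "\<forall>e\<in>#D. \<forall>f\<in>#exponents b. f \<le> e \<Longrightarrow>
    steps s (omega_sum (D + exponents b)) i = steps s (omega_sum D) (steps s b i)" for b
  proof (induction b arbitrary: i rule: less_induct)
    case (less b)
    show ?case
    proof (cases b rule: eps0_minE)
      case (2 g B)
      then have "b \<noteq> 0" by simp
      have fs: "exponents (fund_seq b n) = B + fund_terms g n" for n
        using 2 by (simp add: fund_seq_omega_sum)
      have m: "\<forall>e\<in>#D. \<forall>f\<in>#exponents (fund_seq b n). f \<le> e" for n
        using less.prems 2 unfolding fs by (fastforce dest: fund_terms_less)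
      have "fund_seq (omega_sum (D + exponents b)) n = omega_sum (D + exponents (fund_seq b n))" for n
        using fund_seq_omega_sum[of "D + B" g n] 2 less.prems unfolding fs
        by (auto simp: add.assoc)
      moreover have "omega_sum (D + exponents b) \<noteq> 0" using \<open>b \<noteq> 0\<close> by simp
      ultimately show ?thesis
        using less.IH[OF fund_seq_less[OF \<open>b \<noteq> 0\<close>] m] \<open>b \<noteq> 0\<close> by (simp add: steps_nonzero)
    qed simp
  qed
  from this[of "omega_sum B"] assms show ?thesis by simp
qed

section \<open>Growth of descent indices along a strictly increasing positive orbit\<close>

context
  fixes s :: "nat \<Rightarrow> nat"
  assumes mono: "strict_mono s" and pos: "s 0 > 0"
begin

lemma sequence_add_le: "i \<le> j \<Longrightarrow> s i + (j - i) \<le> s j"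
proof (induction j)
  case (Suc j)
  then show ?case using strict_monoD[OF mono, of j "Suc j"] by (cases "i = Suc j") auto
qed simp

lemma sequence_gt: "i < s i"
  using sequence_add_le[of 0 i] pos by simp

lemma sequence_pos: "0 < s i"
  using sequence_gt[of i] by simp

lemma sequence_mono: "i \<le> j \<Longrightarrow> s i \<le> s j"
  using sequence_add_le[of i j] by simp

text \<open>Each step advances the index by one and lowers the norm by at most one.\<close>

lemma steps_ge_norm: "i + norm a \<le> steps s a i"
proof (induction a arbitrary: i rule: less_induct)
  case (less a)
  show ?case
  proof (cases "a = 0")
    case False
    have "i + norm a \<le> Suc i + norm (fund_seq a (s i))"
      using norm_le_fund_seq[OF sequence_pos[of i], of a] by simp
    also have "\<dots> \<le> steps s a i"
      using less[OF fund_seq_less[OF False], of "Suc i" "s i"] False by (simp add: steps_nonzero)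
    finally show ?thesis .
  qed simp
qed

text \<open>The claims are interlocked: the first at \<open>a\<close> uses both at
  \<open>fund_seq a (s i)\<close>, and the second at \<open>a\<close> uses the first at
  \<open>a\<close>.\<close>

lemma steps_reach_and_Suc:
  "(\<forall>i b. reach (s i) a b \<longrightarrow> steps s b i \<le> steps s a i) \<and>
   (\<forall>i. steps s a i \<le> steps s a (Suc i))"
proof (induction a rule: less_induct)
  case (less a)
  show ?case
  proof (cases "a = 0")
    case True
    then show ?thesis by (auto dest: reach_from_zero)
  next
    case False
    have reach: "steps s b i \<le> steps s a i" if "reach (s i) a b" for i b
    proof (cases "a = b")
      case neq: False
      with that have "reach (s i) (fund_seq a (s i)) b" by (auto elim: reach.cases)
      then have "steps s b i \<le> steps s (fund_seq a (s i)) i"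
        using less[OF fund_seq_less[OF False]] by blast
      also have "\<dots> \<le> steps s (fund_seq a (s i)) (Suc i)"
        using less[OF fund_seq_less[OF False]] by blast
      finally show ?thesis using False by (simp add: steps_nonzero)
    qed simp
    \<comment> \<open>The result of the step at index \<open>i\<close> is also reached with the
      larger parameter of the next index.\<close>
    have "reach (s (Suc i)) a (fund_seq a (s i))" for i
      by (rule reach.step, rule reach_fund_seq_mono) (simp_all add: sequence_pos sequence_mono)
    then have "steps s a i \<le> steps s a (Suc i)" for i
      using reach[of "Suc i"] False by (simp add: steps_nonzero[of a s i])
    with reach show ?thesis by blast
  qed
qed

lemma steps_reach: "reach (s i) a b \<Longrightarrow> steps s b i \<le> steps s a i"
  using steps_reach_and_Suc by blast

lemma steps_mono: "i \<le> j \<Longrightarrow> steps s a i \<le> steps s a j"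
  using steps_reach_and_Suc lift_Suc_mono_le[of "steps s a"] by blast

text \<open>Terms are compared one by one, the largest of \<open>C\<close> being consumed last.
  Replacing the others only delays its start, and at the later index \<open>p\<close> still reaches
  its exponent.\<close>

lemma steps_le_replicate:
  assumes "\<forall>f\<in>#C. reach (s j) p f" "size C \<le> n"
  shows "steps s (omega_sum C) j \<le> steps s (omega_sum (replicate_mset n p)) j"
  using assms
proof (induction n arbitrary: C)
  case (Suc n)
  show ?case
  proof (cases "C = {#}")
    case True
    then show ?thesis using steps_ge_norm[of j] by (auto intro: add_leD1)
  next
    case False
    define f where "f = Max (set_mset C)"
    have "f \<in># C" "\<forall>c\<in>#C. c \<le> f" using False by (simp_all add: f_def)
    then obtain C' where C: "C = {#f#} + C'" and C': "\<forall>c\<in>#C'. c \<le> f"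
      by (metis add_mset_add_single insert_iff multi_member_split set_mset_add_mset_insert union_commute)
    let ?w = "steps s (omega_sum (replicate_mset n p)) j"
    have "j \<le> ?w" using steps_ge_norm[of j] by (rule add_leD1)
    have "reach (s ?w) p f"
      by (rule reach_mono[of "s j"]) (use Suc.prems C \<open>j \<le> ?w\<close> in \<open>simp_all add: sequence_pos sequence_mono\<close>)
    then have r: "reach (s ?w) (omega_sum {#p#}) (omega_sum {#f#})"
      by (rule reach_omega_power) (rule sequence_pos)
    have "steps s (omega_sum C) j = steps s (omega_sum {#f#}) (steps s (omega_sum C') j)"
      unfolding C by (rule steps_union) (use C' in auto)
    also have "\<dots> \<le> steps s (omega_sum {#f#}) ?w"
      by (rule steps_mono, rule Suc.IH) (use Suc.prems C in auto)
    also have "\<dots> \<le> steps s (omega_sum {#p#}) ?w"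
      by (rule steps_reach[OF r])
    also have "\<dots> = steps s (omega_sum ({#p#} + replicate_mset n p)) j"
      by (rule steps_union[symmetric]) (auto split: if_splits)
    finally show ?thesis by simp
  qed
qed simp

lemma steps_fund_terms_above:
  assumes S: "\<forall>e\<in>#S. e < g" "S \<noteq> {#}"
  shows "steps s (omega_sum (S + fund_terms g (s i))) (Suc i) \<le> steps s (omega_sum (add_mset g S)) i"
proof -
  define z where "z = steps s (omega_sum S) i"
  have z: "i + norm (omega_sum S) \<le> z" unfolding z_def by (rule steps_ge_norm)
  have "size S > 0" using S(2) by (simp add: nonempty_has_size)
  with z size_le_norm[of S] have "i < z" by simp
  have small: "norm e < z" if "e \<in># S" for e using norm_exponent[OF that] z by simp
  have "z < s z" by (rule sequence_gt)
  \<comment> \<open>What \<open>p\<close> must provide: from index \<open>z\<close> on, \<omega>^g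
    dominates \<omega>^(p+1), whose step gives \<open>s z\<close> copies of \<omega>^p, enough in
    number and size to cover the left side.\<close>
  have "\<exists>p. reach (s z) g (successor p) \<and> (\<forall>f\<in>#S + fund_terms g (s i). reach (s z) p f) \<and>
      size (S + fund_terms g (s i)) \<le> s z"
  proof (cases g rule: eps0_cases)
    case 1
    with S show ?thesis by (metis eps0_zero_le leD multiset_nonemptyE)
  next
    case (2 p)
    \<comment> \<open>From \<open>i\<close> to \<open>z\<close> the sequence gains at least
      \<open>z - i\<close>, which is at least the norm of S; this makes room for \<open>S\<close>
      beside the \<open>s i\<close> copies of \<omega>^p.\<close>
    have "size S + s i \<le> s z"
      using sequence_add_le[of i z] z size_le_norm[of S] by simp
    moreover have "reach (s z) p f" if "f \<in># S" for f
      by (rule reach_norm) (use that S 2 small[OF that] \<open>z < s z\<close> in \<open>auto simp: less_successor_iff\<close>)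
    ultimately show ?thesis using 2 by (intro exI[of _ p]) auto
  next
    case 3
    define e where "e = fund_seq g (s i)"
    define p where "p = Max (insert e (set_mset S))"
    have p: "e \<le> p" "\<forall>f\<in>#S. f \<le> p" "p = e \<or> p \<in># S"
      using Max_in[of "insert e (set_mset S)"] by (auto simp: p_def)
    have e: "e < g" unfolding e_def using 3 by (simp add: fund_seq_less is_limit_def)
    have "p < g" using p(3) e S by auto
    have "reach 1 p e" using bachmann_property[of 1 g "s i" p] p(1) \<open>p < g\<close> by (simp add: e_def)
    then have "reach (s z) p e" by (rule reach_mono) (use sequence_pos[of z] in auto)
    moreover have "reach (s z) p f" if "f \<in># S" for f
      by (rule reach_norm) (use that p small[OF that] \<open>z < s z\<close> in auto)
    moreover have "reach (s z) g (successor p)"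
    proof (cases "p \<in># S")
      case True
      then show ?thesis
        using \<open>p < g\<close> small[OF True] \<open>z < s z\<close> by (intro reach_norm) (auto simp: successor_le_iff)
    next
      case False
      then have "p = e" using p(3) by simp
      \<comment> \<open>No norm bound for \<open>e\<close> is at hand. Instead
        \<open>fund_seq g (s z)\<close> lies strictly above \<open>e\<close>, and parameter 2 is
        available because \<open>0 < s i < s z\<close>.\<close>
      have "s i < s z" using \<open>i < z\<close> mono by (simp add: strict_mono_less)
      have "reach 1 (fund_seq g (s z)) e" "fund_seq g (s z) \<noteq> e"
        using \<open>s i < s z\<close> fund_seq_strict_mono[OF 3 \<open>s i < s z\<close>]
        by (simp_all add: e_def reach_fund_seq_mono)
      then have "reach 2 (fund_seq g (s z)) (successor e)" by (rule reach_successor)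
      then have "reach (s z) (fund_seq g (s z)) (successor e)"
        by (rule reach_mono) (use \<open>s i < s z\<close> sequence_pos[of i] in auto)
      then show ?thesis using \<open>p = e\<close> by (simp add: reach.step)
    qed
    moreover have "size S + 1 \<le> s z" using z size_le_norm[of S] \<open>z < s z\<close> by simp
    ultimately show ?thesis using 3 by (intro exI[of _ p]) (auto simp: e_def)
  qed
  then obtain p where p: "reach (s z) g (successor p)"
    "\<forall>f\<in>#S + fund_terms g (s i). reach (s z) p f" "size (S + fund_terms g (s i)) \<le> s z" by blast
  \<comment> \<open>Expanding \<omega>^(p+1) at \<open>z\<close> takes one step, so the comparison
    happens at \<open>Suc z\<close>.\<close>
  have "\<forall>f\<in>#S + fund_terms g (s i). reach (s (Suc z)) p f"
    using p(2) reach_mono[of "s z" p _ "s (Suc z)"] by (simp add: sequence_pos sequence_mono)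
  then have "steps s (omega_sum (S + fund_terms g (s i))) (Suc z)
      \<le> steps s (omega_sum (replicate_mset (s z) p)) (Suc z)"
    using p(3) by (rule steps_le_replicate)
  moreover have "steps s (omega_sum (S + fund_terms g (s i))) (Suc i)
      \<le> steps s (omega_sum (S + fund_terms g (s i))) (Suc z)"
    by (rule steps_mono) (use \<open>i < z\<close> in simp)
  moreover have "steps s (omega_sum (replicate_mset (s z) p)) (Suc z) = steps s (omega_sum {#successor p#}) z"
    by (simp add: steps_nonzero[of "omega_sum {#successor p#}"] fund_seq_omega_sum)
  moreover have "\<dots> \<le> steps s (omega_sum {#g#}) z"
    by (intro steps_reach reach_omega_power p(1) sequence_pos)
  moreover have "\<dots> = steps s (omega_sum ({#g#} + S)) i"
    unfolding z_def by (rule steps_union[symmetric]) (use S in auto)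
  ultimately show ?thesis by simp
qed

text \<open>Terms with exponents at least \<open>g\<close> come last in both descents and preserve
  the inequality by monotonicity in the starting index. If no exponent is below \<open>g\<close>,
  both sides agree.\<close>

lemma steps_fund_terms:
  "steps s (omega_sum (S + fund_terms g (s i))) (Suc i) \<le> steps s (omega_sum (add_mset g S)) i"
proof -
  define T where "T = filter_mset (\<lambda>e. g \<le> e) S"
  define U where "U = filter_mset (\<lambda>e. \<not> g \<le> e) S"
  have S: "S = T + U" unfolding T_def U_def by (rule multiset_partition)
  have T: "\<forall>e\<in>#T. g \<le> e" and U: "\<forall>e\<in>#U. e < g" by (auto simp: T_def U_def)
  have le: "steps s (omega_sum (U + fund_terms g (s i))) (Suc i) \<le> steps s (omega_sum (add_mset g U)) i"
  proof (cases "U = {#}")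
    case True
    then show ?thesis by (simp add: steps_nonzero[of "omega_sum {#g#}"] fund_seq_omega_sum)
  qed (use steps_fund_terms_above U in blast)
  have "steps s (omega_sum (T + (U + fund_terms g (s i)))) (Suc i)
      = steps s (omega_sum T) (steps s (omega_sum (U + fund_terms g (s i))) (Suc i))"
    by (rule steps_union) (use T U in \<open>fastforce dest: fund_terms_less\<close>)
  also have "\<dots> \<le> steps s (omega_sum T) (steps s (omega_sum (add_mset g U)) i)"
    by (rule steps_mono[OF le])
  also have "\<dots> = steps s (omega_sum (T + add_mset g U)) i"
    by (rule steps_union[symmetric]) (use T U in force)
  finally show ?thesis by (simp add: S add.assoc)
qed

text \<open>The last term of \<open>b\<close> may sit anywhere in \<open>b \<oplus> a\<close>, hence
  the arbitrary \<open>S\<close> in \<open>steps_fund_terms\<close>.\<close>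

lemma steps_natural_sum:
  assumes "b \<noteq> 0"
  shows "steps s (fund_seq b (s i) \<oplus> a) (Suc i) \<le> steps s (b \<oplus> a) i"
proof (cases b rule: eps0_minE)
  case (2 g D)
  then show ?thesis
    using steps_fund_terms[of "D + exponents a" g i]
    by (simp add: fund_seq_omega_sum natural_sum_omega_sum ac_simps)
qed (use assms in simp)

end

text \<open>Being defined means that the orbit stays in \<open>A\<close> until the descent ends, so
  partial values along one orbit are compared through indices.\<close>

lemma hardy_eq_Some_iff_steps:
  assumes "\<And>i. s i \<in> A \<Longrightarrow> s (Suc i) = h (s i)"
  shows "hardy A h a (s i) = Some v \<longleftrightarrow>
    (\<forall>j. i \<le> j \<longrightarrow> j < steps s a i \<longrightarrow> s j \<in> A) \<and> v = s (steps s a i)"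
proof (induction a arbitrary: i rule: less_induct)
  case (less a)
  show ?case
  proof (cases "a = 0")
    case True
    then show ?thesis by (auto simp: hardy.simps)
  next
    case False
    have "Suc i \<le> steps s b (Suc i)" for b
      by (induction b arbitrary: i rule: less_induct)
        (metis Suc_leD fund_seq_less order_refl steps_nonzero steps_zero)
    then have lt: "i < steps s a i" using False by (simp add: steps_nonzero Suc_le_lessD)
    have split: "(\<forall>j. i \<le> j \<longrightarrow> j < n \<longrightarrow> s j \<in> A) \<longleftrightarrow>
        s i \<in> A \<and> (\<forall>j. Suc i \<le> j \<longrightarrow> j < n \<longrightarrow> s j \<in> A)" if "i < n" for n
      using that by (metis Suc_leD Suc_leI le_eq_less_or_eq order_refl)
    show ?thesis
    proof (cases "s i \<in> A")
      case True
      then have "hardy A h a (s i) = hardy A h (fund_seq a (s i)) (s (Suc i))"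
        using False assms by (subst hardy.simps) simp
      with less.IH[OF fund_seq_less[OF False], of "s i" "Suc i"] True split[OF lt] False show ?thesis
        by (simp add: steps_nonzero)
    next
      case notin: False
      then show ?thesis using False lt by (subst hardy.simps) auto
    qed
  qed
qed

theorem mainTheorem3:
  fixes A :: "nat set" and h :: "nat \<Rightarrow> nat" and \<alpha> \<beta> :: eps0 and x :: nat
  assumes "mono_on A h"
    and "\<And>a. a \<in> A \<Longrightarrow> h a > a"
    and "\<beta> > 0"
    and "x > 0"
    and "x \<in> dom (hardy A h (\<beta> \<oplus> \<alpha>))"
  shows "x \<in> A \<and> h x \<in> dom (hardy A h (fund_seq \<beta> x \<oplus> \<alpha>)) \<and>
         hardy A h (\<beta> \<oplus> \<alpha>) x = hardy A h (fund_seq (\<beta> \<oplus> \<alpha>) x) (h x) \<and>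
         the (hardy A h (fund_seq (\<beta> \<oplus> \<alpha>) x) (h x)) \<ge> the (hardy A h (fund_seq \<beta> x \<oplus> \<alpha>) (h x))"
proof -
  \<comment> \<open>Outside \<open>A\<close> the orbit is continued arbitrarily, keeping it strictly increasing.\<close>
  define k where "k = (\<lambda>y. if y \<in> A then h y else Suc y)"
  define s where "s = (\<lambda>i. (k ^^ i) x)"
  have s_Suc: "s (Suc i) = k (s i)" and s_0: "s 0 = x" for i by (simp_all add: s_def)
  have "strict_mono s" by (simp add: strict_mono_Suc_iff s_Suc k_def assms(2))
  have "s 0 > 0" using assms(4) by (simp add: s_0)
  have s_in: "s (Suc i) = h (s i)" if "s i \<in> A" for i using that by (simp add: s_Suc k_def)
  note iff = hardy_eq_Some_iff_steps[of s A h, OF s_in]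
  have "\<beta> \<noteq> 0" using assms(3) by auto
  then have ne: "\<beta> \<oplus> \<alpha> \<noteq> 0" by (simp add: natural_sum_omega_sum)
  obtain v where v: "hardy A h (\<beta> \<oplus> \<alpha>) x = Some v" using assms(5) by blast
  have "x \<in> A" using v ne by (subst (asm) hardy.simps) (simp split: if_splits)
  then have unfold: "hardy A h (\<beta> \<oplus> \<alpha>) x = hardy A h (fund_seq (\<beta> \<oplus> \<alpha>) x) (h x)"
    using ne by (subst hardy.simps) simp
  have "s 1 = h x" using s_in[of 0] s_0 \<open>x \<in> A\<close> by simp
  have le: "steps s (fund_seq \<beta> x \<oplus> \<alpha>) 1 \<le> steps s (\<beta> \<oplus> \<alpha>) 0"
    using steps_natural_sum[OF \<open>strict_mono s\<close> \<open>s 0 > 0\<close> \<open>\<beta> \<noteq> 0\<close>, of 0 \<alpha>] by (simp add: s_0)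
  have "\<forall>j. j < steps s (\<beta> \<oplus> \<alpha>) 0 \<longrightarrow> s j \<in> A" "v = s (steps s (\<beta> \<oplus> \<alpha>) 0)"
    using iff[of "\<beta> \<oplus> \<alpha>" 0 v] v by (simp_all add: s_0)
  \<comment> \<open>This descent starts at index 1, as \<open>h x\<close> is \<open>s 1\<close>, and
    ends no later than the one from index 0; every orbit point it tests is already known to lie in
    \<open>A\<close>.\<close>
  then have "hardy A h (fund_seq \<beta> x \<oplus> \<alpha>) (h x) = Some (s (steps s (fund_seq \<beta> x \<oplus> \<alpha>) 1))"
    and "s (steps s (fund_seq \<beta> x \<oplus> \<alpha>) 1) \<le> v"
    using iff[of "fund_seq \<beta> x \<oplus> \<alpha>" 1] le \<open>s 1 = h x\<close> \<open>strict_mono s\<close>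
    by (auto simp: strict_mono_less_eq)
  with \<open>x \<in> A\<close> unfold v show ?thesis by (metis domI option.sel)
qed

end
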